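(* Let $(w,w_0)$ be a weight function, $\succsim$ a quasi-precedence and $\sigma$ a status. If $w_0>0$ and $w$ is admissible for $\succsim$, then $\succ_{\mathrm{WPO}(\mathcal A_{\mathrm{sum}})}=\succ_{\mathrm{KBO}}$, where $\mathcal A_{\mathrm{sum}}$ is the algebra induced by $(w,w_0)$ and both orders use $\succsim$ and $\sigma$.
   Context: Terms over a finite signature $\Sigma$ and variables $\mathcal V$; $|s|_x$ is the number of occurrences of $x$ in $s$. A weight function $(w,w_0)$ consists of $w:\Sigma\to\mathbb N$ and $w_0\in\mathbb N$ with $w(c)\ge w_0$ for all constants $c$. Weight of terms: $w(x)=w_0$ for variables, $w(f(s_1,\dots,s_n))=w(f)+\sum_i w(s_i)$. $w$ is admissible for $\succsim$ iff every unary $f$ with $w(f)=0$ satisfies $f\succsim g$ for all $g\in\Sigma$. A quasi-precedence $\succsim$ is a quasi-order on $\Sigma$ with well-founded strict part $\succ$ and equivalence $\sim$. A status $\sigma$ maps $f\in\Sigma_n$ to a permutation $[i_1,\dots,i_n]$ of $\{1,\dots,n\}$; $\sigma(f)(s_1,\dots,s_n)=[s_{i_1},\dots,s_{i_n}]$. For a strict order $\succ$ with reflexive closure $\succeq$: $[s_1,\dots,s_n]\succ^{\mathrm{lex}}[t_1,\dots,t_m]$ iff there is $k<n$ with $s_i\succeq t_i$ for $i\le k$ and either $k=m$, or $k<m$ and $s_{k+1}\succ t_{k+1}$. KBO: $s=f(s_1,\dots,s_n)\succ_{\mathrm{KBO}}t$ iff $|s|_x\ge|t|_x$ for all $x\in\mathcal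 V$ and either $w(s)>w(t)$, or $w(s)=w(t)$ and either (a) $t\in\mathcal V$ and $s=f^k(t)$ for some $k>0$, or (b) $t=g(t_1,\dots,t_m)$ and $f\succ g$, or $f\sim g$ and $\sigma(f)(s_1..s_n)\succ_{\mathrm{KBO}}^{\mathrm{lex}}\sigma(g)(t_1..t_m)$. Variables are greater than nothing. $\mathcal A_{\mathrm{sum}}$: carrier $\{a\in\mathbb N\mid a\ge w_0\}$ with the usual $\ge,>$, and $f_{\mathcal A}(a_1,\dots,a_n)=w(f)+\sum_i a_i$. On terms $s\ge_{\mathcal A}t$ (resp. $>_{\mathcal A}$) iff $\hat\alpha(s)\ge\hat\alpha(t)$ (resp. $>$) for all assignments $\alpha$ into the carrier. WPO for an algebra $\mathcal A$: no variable is greater than any term; $s=f(s_1,\dots,s_n)\succ_{\mathrm{WPO}(\mathcal A)}t$ iff (1) $s>_{\mathcal A}t$, or (2) $s\ge_{\mathcal A}t$ and either (a) $s_i\succeq_{\mathrm{WPO}(\mathcal A)}t$ for some $i$, or (b) $t=g(t_1,\dots,t_m)$, $s\succ_{\mathrm{WPO}(\mathcal A)}t_j$ for all $j$, and $f\succ g$, or $f\sim g$ and $\sigma(f)(s_1..s_n)\succ_{\mathrm{WPO}(\mathcal A)}^{\mathrm{lex}}\sigma(g)(t_1..t_m)$.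
   Formalization: In KBO case (a), s = f^k(t) is read up to ∼: s = f1(…fk(t)…) with k>0 and all fi ∼ f. Read literally the claim fails: for distinct unary f ∼ g of weight 0, f(g(x)) exceeds x in WPO but not in KBO. With at most one unary symbol of weight 0 the two readings agree. *)

theory Defs
  imports Main
begin

datatype ('f, 'v) trm = Var 'v | Fun 'f "('f, 'v) trm list"

text \<open>A signature is a set \<open>Sig\<close> of symbols with an arity function \<open>ar\<close>; its terms are those
  satisfying \<open>wf_trm Sig ar\<close>.\<close>

fun wf_trm :: "'f set \<Rightarrow> ('f \<Rightarrow> nat) \<Rightarrow> ('f, 'v) trm \<Rightarrow> bool" where
  "wf_trm Sig ar (Var x) \<longleftrightarrow> True"
| "wf_trm Sig ar (Fun f ss) \<longleftrightarrow>
     f \<in> Sig \<and> length ss = ar f \<and> (\<forall>s\<in>set ss. wf_trm Sig ar s)"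

definition terms :: "'f set \<Rightarrow> ('f \<Rightarrow> nat) \<Rightarrow> ('f, 'v) trm set" where
  "terms Sig ar = {s. wf_trm Sig ar s}"

fun occ :: "'v \<Rightarrow> ('f, 'v) trm \<Rightarrow> nat" where
  "occ x (Var y) = (if x = y then 1 else 0)"
| "occ x (Fun f ss) = sum_list (map (occ x) ss)"


subsection \<open>Weights, precedences, statuses\<close>

definition weight_function :: "'f set \<Rightarrow> ('f \<Rightarrow> nat) \<Rightarrow> ('f \<Rightarrow> nat) \<Rightarrow> nat \<Rightarrow> bool" where
  "weight_function Sig ar w w0 \<longleftrightarrow> (\<forall>c\<in>Sig. ar c = 0 \<longrightarrow> w c \<ge> w0)"

fun wt :: "('f \<Rightarrow> nat) \<Rightarrow> nat \<Rightarrow> ('f, 'v) trm \<Rightarrow> nat" where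
  "wt w w0 (Var x) = w0"
| "wt w w0 (Fun f ss) = w f + sum_list (map (wt w w0) ss)"

definition strict :: "('a \<Rightarrow> 'a \<Rightarrow> bool) \<Rightarrow> 'a \<Rightarrow> 'a \<Rightarrow> bool" where
  "strict P f g \<longleftrightarrow> P f g \<and> \<not> P g f"

definition equivalent :: "('a \<Rightarrow> 'a \<Rightarrow> bool) \<Rightarrow> 'a \<Rightarrow> 'a \<Rightarrow> bool" where
  "equivalent P f g \<longleftrightarrow> P f g \<and> P g f"

text \<open>\<open>P f g\<close> stands for \<open>f \<succsim> g\<close>. The relation passed to \<^const>\<open>wfp_on\<close> has the smaller
  element first, hence the swapped arguments.\<close>

definition quasi_precedence :: "'f set \<Rightarrow> ('f \<Rightarrow> 'f \<Rightarrow> bool) \<Rightarrow> bool" where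
  "quasi_precedence Sig P \<longleftrightarrow>
     reflp_on Sig P \<and> transp_on Sig P \<and> wfp_on Sig (\<lambda>g f. strict P f g)"

definition admissible ::
    "'f set \<Rightarrow> ('f \<Rightarrow> nat) \<Rightarrow> ('f \<Rightarrow> nat) \<Rightarrow> ('f \<Rightarrow> 'f \<Rightarrow> bool) \<Rightarrow> bool" where
  "admissible Sig ar w P \<longleftrightarrow> (\<forall>f\<in>Sig. ar f = 1 \<and> w f = 0 \<longrightarrow> (\<forall>g\<in>Sig. P f g))"

text \<open>Argument positions are counted from 0.\<close>

definition status :: "'f set \<Rightarrow> ('f \<Rightarrow> nat) \<Rightarrow> ('f \<Rightarrow> nat list) \<Rightarrow> bool" where
  "status Sig ar \<sigma> \<longleftrightarrow> (\<forall>f\<in>Sig. distinct (\<sigma> f) \<and> set (\<sigma> f) = {0..<ar f})"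

definition permute :: "nat list \<Rightarrow> 'a list \<Rightarrow> 'a list" where
  "permute p ss = map (\<lambda>i. ss ! i) p"

definition lex_ext :: "('a \<Rightarrow> 'a \<Rightarrow> bool) \<Rightarrow> 'a list \<Rightarrow> 'a list \<Rightarrow> bool" where
  "lex_ext R ss ts \<longleftrightarrow>
     (\<exists>k < length ss. k \<le> length ts \<and> (\<forall>i<k. R (ss ! i) (ts ! i) \<or> ss ! i = ts ! i) \<and>
        (k = length ts \<or> k < length ts \<and> R (ss ! k) (ts ! k)))"

lemma lex_ext_mono [mono]:
  assumes "\<And>s t. R s t \<longrightarrow> S s t"
  shows "lex_ext R ss ts \<longrightarrow> lex_ext S ss ts"
  unfolding lex_ext_def using assms by blast


subsection \<open>Knuth-Bendix order\<close>

text \<open>\<open>stack [f\<^sub>1, \<dots>, f\<^sub>k] t = f\<^sub>1(\<dots>f\<^sub>k(t)\<dots>)\<close>; in particular \<open>stack (replicate k f) t = f\<^sup>k(t)\<close>.\<close>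

definition stack :: "'f list \<Rightarrow> ('f, 'v) trm \<Rightarrow> ('f, 'v) trm" where
  "stack fs t = foldr (\<lambda>f u. Fun f [u]) fs t"

text \<open>In the rule \<open>var\<close>, the condition \<open>s = f\<^sup>k(t)\<close> with \<open>k > 0\<close> is read up to the equivalence
  \<open>\<sim>\<close> of the quasi-precedence: \<open>s = f\<^sub>1(\<dots>f\<^sub>k(t)\<dots>)\<close> with all \<open>f\<^sub>i \<sim> f\<close>. With literal iterates
  of the single symbol \<open>f\<close> the relation would not be transitive: for two unary symbols
  \<open>f \<sim> g\<close> of weight 0 one has \<open>f(g(x)) \<succ> g(x) \<succ> x\<close>, but \<open>f(g(x))\<close> is not an iterate \<open>f\<^sup>k(x)\<close>.
  The two readings agree unless there are two distinct unary symbols of weight 0; see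
  \<open>stack_equivalent_iff_iterate\<close> below.\<close>

inductive kbo :: "('f \<Rightarrow> nat) \<Rightarrow> nat \<Rightarrow> ('f \<Rightarrow> 'f \<Rightarrow> bool) \<Rightarrow> ('f \<Rightarrow> nat list) \<Rightarrow>
    ('f, 'v) trm \<Rightarrow> ('f, 'v) trm \<Rightarrow> bool"
  for w :: "'f \<Rightarrow> nat" and w0 :: nat and P :: "'f \<Rightarrow> 'f \<Rightarrow> bool" and \<sigma> :: "'f \<Rightarrow> nat list" where
  weight: "kbo w w0 P \<sigma> (Fun f ss) t"
    if "\<forall>x. occ x (Fun f ss) \<ge> occ x t" "wt w w0 (Fun f ss) > wt w w0 t"
| var: "kbo w w0 P \<sigma> (Fun f ss) (Var y)"
    if "\<forall>x. occ x (Fun f ss) \<ge> occ x (Var y :: ('f, 'v) trm)"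
      "wt w w0 (Fun f ss) = wt w w0 (Var y)"
      "\<exists>fs. fs \<noteq> [] \<and> (\<forall>g\<in>set fs. equivalent P f g) \<and> Fun f ss = stack fs (Var y)"
| prec: "kbo w w0 P \<sigma> (Fun f ss) (Fun g ts)"
    if "\<forall>x. occ x (Fun f ss) \<ge> occ x (Fun g ts)" "wt w w0 (Fun f ss) = wt w w0 (Fun g ts)"
      "strict P f g"
| lex: "kbo w w0 P \<sigma> (Fun f ss) (Fun g ts)"
    if "\<forall>x. occ x (Fun f ss) \<ge> occ x (Fun g ts)" "wt w w0 (Fun f ss) = wt w w0 (Fun g ts)"
      "equivalent P f g" "lex_ext (kbo w w0 P \<sigma>) (permute (\<sigma> f) ss) (permute (\<sigma> g) ts)"

definition KBO :: "'f set \<Rightarrow> ('f \<Rightarrow> nat) \<Rightarrow> ('f \<Rightarrow> nat) \<Rightarrow> nat \<Rightarrow> ('f \<Rightarrow> 'f \<Rightarrow> bool) \<Rightarrow>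
    ('f \<Rightarrow> nat list) \<Rightarrow> (('f, 'v) trm \<times> ('f, 'v) trm) set" where
  "KBO Sig ar w w0 P \<sigma> =
     {(s, t). s \<in> terms Sig ar \<and> t \<in> terms Sig ar \<and> kbo w w0 P \<sigma> s t}"

lemma wt_stack: "wt w w0 (stack fs t) = sum_list (map w fs) + wt w w0 t"
  by (induction fs) (simp_all add: stack_def)

lemma wf_stack: "wf_trm Sig ar (stack fs t) \<Longrightarrow> g \<in> set fs \<Longrightarrow> g \<in> Sig \<and> ar g = 1"
  by (induction fs) (auto simp: stack_def)

lemma stack_equivalent_iff_iterate:
  assumes "quasi_precedence Sig P" and "wf_trm Sig ar (Fun f ss)"
    and "wt w w0 (Fun f ss) = wt w w0 t"
    and uniq: "\<And>g h. \<lbrakk>g \<in> Sig; h \<in> Sig; ar g = 1; ar h = 1; w g = 0; w h = 0\<rbrakk> \<Longrightarrow> g = h"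
  shows "(\<exists>fs. fs \<noteq> [] \<and> (\<forall>g\<in>set fs. equivalent P f g) \<and> Fun f ss = stack fs t) \<longleftrightarrow>
    (\<exists>k>0. Fun f ss = stack (replicate k f) t)" (is "?L \<longleftrightarrow> ?R")
proof
  assume ?L
  then obtain fs where fs: "fs \<noteq> []" "Fun f ss = stack fs t" by blast
  have "sum_list (map w fs) = 0" using assms(3) fs(2) by (simp only: wt_stack)
  then have zero: "g \<in> Sig \<and> ar g = 1 \<and> w g = 0" if "g \<in> set fs" for g
    using that wf_stack[of Sig ar fs t g] assms(2)[unfolded fs(2)] by simp
  have "f \<in> set fs" using fs by (cases fs) (auto simp: stack_def)
  then have "g = f" if "g \<in> set fs" for g
    using uniq[of g f] zero[OF that] zero[of f] by simp
  then have "\<exists>k. fs = replicate k f" by (metis replicate_length_same)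
  then obtain k where "fs = replicate k f" ..
  with fs have "k > 0" "Fun f ss = stack (replicate k f) t" by auto
  then show ?R by blast
next
  assume ?R
  then obtain k where k: "k > 0" "Fun f ss = stack (replicate k f) t" by blast
  have "equivalent P f f"
    using assms(1,2) by (simp add: quasi_precedence_def equivalent_def reflp_on_def)
  then have "replicate k f \<noteq> []" "\<forall>g\<in>set (replicate k f). equivalent P f g"
    using k(1) by auto
  then show ?L using k(2) by blast
qed


subsection \<open>Weighted path order\<close>

record ('f, 'a) algebra =
  car :: "'a set"
  interp :: "'f \<Rightarrow> 'a list \<Rightarrow> 'a"
  ge :: "'a \<Rightarrow> 'a \<Rightarrow> bool"
  gt :: "'a \<Rightarrow> 'a \<Rightarrow> bool"

fun eval :: "('f, 'a) algebra \<Rightarrow> ('v \<Rightarrow> 'a) \<Rightarrow> ('f, 'v) trm \<Rightarrow> 'a" where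
  "eval A \<alpha> (Var x) = \<alpha> x"
| "eval A \<alpha> (Fun f ss) = interp A f (map (eval A \<alpha>) ss)"

definition alg_ge :: "('f, 'a) algebra \<Rightarrow> ('f, 'v) trm \<Rightarrow> ('f, 'v) trm \<Rightarrow> bool" where
  "alg_ge A s t \<longleftrightarrow> (\<forall>\<alpha>. (\<forall>x. \<alpha> x \<in> car A) \<longrightarrow> ge A (eval A \<alpha> s) (eval A \<alpha> t))"

definition alg_gt :: "('f, 'a) algebra \<Rightarrow> ('f, 'v) trm \<Rightarrow> ('f, 'v) trm \<Rightarrow> bool" where
  "alg_gt A s t \<longleftrightarrow> (\<forall>\<alpha>. (\<forall>x. \<alpha> x \<in> car A) \<longrightarrow> gt A (eval A \<alpha> s) (eval A \<alpha> t))"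

inductive wpo :: "('f, 'a) algebra \<Rightarrow> ('f \<Rightarrow> 'f \<Rightarrow> bool) \<Rightarrow> ('f \<Rightarrow> nat list) \<Rightarrow>
    ('f, 'v) trm \<Rightarrow> ('f, 'v) trm \<Rightarrow> bool"
  for A :: "('f, 'a) algebra" and P :: "'f \<Rightarrow> 'f \<Rightarrow> bool" and \<sigma> :: "'f \<Rightarrow> nat list" where
  alg: "wpo A P \<sigma> (Fun f ss) t"
    if "alg_gt A (Fun f ss) t"
| arg: "wpo A P \<sigma> (Fun f ss) t"
    if "alg_ge A (Fun f ss) t" "i < length ss" "wpo A P \<sigma> (ss ! i) t \<or> ss ! i = t"
| prec: "wpo A P \<sigma> (Fun f ss) (Fun g ts)"
    if "alg_ge A (Fun f ss) (Fun g ts)" "\<forall>j < length ts. wpo A P \<sigma> (Fun f ss) (ts ! j)"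
      "strict P f g"
| lex: "wpo A P \<sigma> (Fun f ss) (Fun g ts)"
    if "alg_ge A (Fun f ss) (Fun g ts)" "\<forall>j < length ts. wpo A P \<sigma> (Fun f ss) (ts ! j)"
      "equivalent P f g" "lex_ext (wpo A P \<sigma>) (permute (\<sigma> f) ss) (permute (\<sigma> g) ts)"

definition WPO :: "'f set \<Rightarrow> ('f \<Rightarrow> nat) \<Rightarrow> ('f, 'a) algebra \<Rightarrow> ('f \<Rightarrow> 'f \<Rightarrow> bool) \<Rightarrow>
    ('f \<Rightarrow> nat list) \<Rightarrow> (('f, 'v) trm \<times> ('f, 'v) trm) set" where
  "WPO Sig ar A P \<sigma> =
     {(s, t). s \<in> terms Sig ar \<and> t \<in> terms Sig ar \<and> wpo A P \<sigma> s t}"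

definition A_sum :: "('f \<Rightarrow> nat) \<Rightarrow> nat \<Rightarrow> ('f, nat) algebra" where
  "A_sum w w0 = \<lparr>car = {a. a \<ge> w0}, interp = (\<lambda>f as. w f + sum_list as), ge = (\<ge>), gt = (>)\<rparr>"

end

theory Submission
  imports Defs
begin

text \<open>On terms, \<open>s \<ge> t\<close> in \<open>\<A>\<^sub>s\<^sub>u\<^sub>m\<close> means exactly that no variable occurs more often in \<open>t\<close> than in \<open>s\<close>
  and \<open>w(s) \<ge> w(t)\<close>, and similarly for \<open>>\<close>; so the two orders can differ only on pairs of equal weight.
  Since \<open>w\<^sub>0 > 0\<close>, an argument \<open>s\<^sub>i\<close> can weigh as much as \<open>f(s\<^sub>1, \<dots>, s\<^sub>n)\<close> only if \<open>f\<close> is unary of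
  weight 0, hence maximal in the precedence. This makes the conditions \<open>s \<succ> t\<^sub>j\<close> of WPO redundant,
  and reduces its rule (2a) to the closure of KBO under adding a unary symbol of weight 0 on top of
  the left-hand side. That closure is proved directly, without using transitivity of KBO.\<close>

section \<open>The algebra of weights\<close>

lemma finite_occ: "finite {x. occ x s > 0}"
proof (induction s)
  case (Fun f ss)
  have "{x. occ x (Fun f ss) > 0} \<subseteq> (\<Union>s\<in>set ss. {x. occ x s > 0})"
    by (auto simp: neq0_conv[symmetric] simp del: neq0_conv)
  then show ?case using Fun by (meson finite_UN_I finite_set finite_subset)
qed simp

lemma sum_list_occ:
  "(\<Sum>x\<in>X. sum_list (map (occ x) ss) * d x) = sum_list (map (\<lambda>s. \<Sum>x\<in>X. occ x s * (d x :: nat)) ss)"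
  by (induction ss) (simp_all add: sum.distrib distrib_right)

text \<open>Evaluation is affine: each occurrence of \<open>x\<close> contributes \<open>w0\<close>,
  already counted in the weight, plus the excess \<open>\<alpha> x - w0\<close>, which is not
  truncated because \<open>\<alpha>\<close> stays in the carrier. Any finite \<open>X\<close>
  containing the variables of \<open>s\<close> will do, so two terms can be summed over a common
  index set.\<close>

lemma eval_A_sum:
  assumes "finite X" "\<And>x. occ x s > 0 \<Longrightarrow> x \<in> X" "\<And>x. \<alpha> x \<ge> w0"
  shows "eval (A_sum w w0) \<alpha> s = wt w w0 s + (\<Sum>x\<in>X. occ x s * (\<alpha> x - w0))"
  using assms(2)
proof (induction s)
  case (Var y)
  then have "y \<in> X" by simp
  have "(\<Sum>x\<in>X. occ x (Var y) * (\<alpha> x - w0)) = (\<Sum>x\<in>X. if x = y then \<alpha> x - w0 else 0)"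
    by (rule sum.cong) auto
  also have "\<dots> = \<alpha> y - w0" using \<open>y \<in> X\<close> assms(1) by simp
  finally show ?case using assms(3)[of y] by simp
next
  case (Fun f ss)
  have "eval (A_sum w w0) \<alpha> s = wt w w0 s + (\<Sum>x\<in>X. occ x s * (\<alpha> x - w0))" if s: "s \<in> set ss" for s
  proof (rule Fun.IH[OF s])
    fix x assume "occ x s > 0"
    then have "occ x (Fun f ss) > 0"
      using s by (auto simp: neq0_conv[symmetric] simp del: neq0_conv)
    then show "x \<in> X" by (rule Fun.prems)
  qed
  then have "map (eval (A_sum w w0) \<alpha>) ss
      = map (\<lambda>s. wt w w0 s + (\<Sum>x\<in>X. occ x s * (\<alpha> x - w0))) ss" by simp
  moreover have "eval (A_sum w w0) \<alpha> (Fun f ss) = w f + sum_list (map (eval (A_sum w w0) \<alpha>) ss)"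
    by (simp add: A_sum_def)
  ultimately show ?case by (simp add: sum_list_occ sum_list_addf del: eval.simps map_eq_conv)
qed

lemma eval_A_sum_const: "eval (A_sum w w0) (\<lambda>_. w0) s = wt w w0 s"
  by (simp add: eval_A_sum[OF finite_occ[of s]])

lemma eval_A_sum_update:
  "eval (A_sum w w0) ((\<lambda>_. w0)(x := w0 + n)) s = wt w w0 s + occ x s * n"
proof -
  let ?X = "insert x {x. occ x s > 0}"
  have "(\<Sum>y\<in>?X. occ y s * (((\<lambda>_. w0)(x := w0 + n)) y - w0))
      = (\<Sum>y\<in>?X. if y = x then occ x s * n else 0)"
    by (rule sum.cong) auto
  also have "\<dots> = occ x s * n" using finite_occ[of s] by simp
  finally show ?thesis
    by (subst eval_A_sum[of ?X]) (use finite_occ[of s] in auto)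
qed

text \<open>Raising the value of \<open>x\<close> alone far enough makes the number of its
  occurrences dominate both weights.\<close>

lemma A_sum_ge_occ:
  assumes "\<And>\<alpha>. (\<And>x. \<alpha> x \<ge> w0) \<Longrightarrow> eval (A_sum w w0) \<alpha> s \<ge> eval (A_sum w w0) \<alpha> t"
  shows "occ x s \<ge> occ x t"
proof (rule ccontr)
  assume "\<not> ?thesis"
  then obtain d where d: "occ x t = occ x s + Suc d"
    by (metis less_natE not_le add_Suc_right)
  \<comment> \<open>With this excess, a single surplus occurrence of \<open>x\<close> in
    \<open>t\<close> already outweighs \<open>wt w w0 s\<close>.\<close>
  define n where "n = Suc (wt w w0 s)"
  have "wt w w0 s + occ x s * n \<ge> wt w w0 t + occ x t * n"
    using assms[of "(\<lambda>_. w0)(x := w0 + n)"] by (simp only: eval_A_sum_update) simp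
  then show False by (simp add: d n_def algebra_simps)
qed

text \<open>The assignment constantly \<open>w0\<close> yields the weights, and raising one variable
  yields its count; conversely the affine form is monotone in both.\<close>

lemma alg_ge_A_sum_iff:
  "alg_ge (A_sum w w0) s t \<longleftrightarrow> (\<forall>x. occ x s \<ge> occ x t) \<and> wt w w0 s \<ge> wt w w0 t"
  (is "_ = ?R")
proof
  assume "alg_ge (A_sum w w0) s t"
  then have ge: "eval (A_sum w w0) \<alpha> s \<ge> eval (A_sum w w0) \<alpha> t" if "\<And>x. \<alpha> x \<ge> w0" for \<alpha>
    using that by (simp add: alg_ge_def A_sum_def)
  show ?R using A_sum_ge_occ[OF ge] ge[of "\<lambda>_. w0"] by (simp add: eval_A_sum_const)
next
  assume R: ?R
  have "eval (A_sum w w0) \<alpha> s \<ge> eval (A_sum w w0) \<alpha> t" if \<alpha>: "\<And>x. \<alpha> x \<ge> w0" for \<alpha>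
  proof -
    let ?X = "{x. occ x s > 0} \<union> {x. occ x t > 0}"
    have fin: "finite ?X" by (simp add: finite_occ)
    show ?thesis
      by (subst (1 2) eval_A_sum[OF fin])
        (use R \<alpha> in \<open>auto intro!: add_mono sum_mono\<close>)
  qed
  then show "alg_ge (A_sum w w0) s t" by (simp add: alg_ge_def A_sum_def)
qed

lemma alg_gt_A_sum_iff:
  "alg_gt (A_sum w w0) s t \<longleftrightarrow> (\<forall>x. occ x s \<ge> occ x t) \<and> wt w w0 s > wt w w0 t"
  (is "_ = ?R")
proof
  assume "alg_gt (A_sum w w0) s t"
  then have gt: "eval (A_sum w w0) \<alpha> s > eval (A_sum w w0) \<alpha> t" if "\<And>x. \<alpha> x \<ge> w0" for \<alpha>
    using that by (simp add: alg_gt_def A_sum_def)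
  show ?R using A_sum_ge_occ[OF less_imp_le[OF gt]] gt[of "\<lambda>_. w0"] by (simp add: eval_A_sum_const)
next
  assume R: ?R
  have "eval (A_sum w w0) \<alpha> s > eval (A_sum w w0) \<alpha> t" if \<alpha>: "\<And>x. \<alpha> x \<ge> w0" for \<alpha>
  proof -
    let ?X = "{x. occ x s > 0} \<union> {x. occ x t > 0}"
    have fin: "finite ?X" by (simp add: finite_occ)
    show ?thesis
      by (subst (1 2) eval_A_sum[OF fin])
        (use R \<alpha> in \<open>auto intro!: add_less_le_mono sum_mono\<close>)
  qed
  then show "alg_gt (A_sum w w0) s t" by (simp add: alg_gt_def A_sum_def)
qed

lemma wpo_imp_alg_ge: "wpo (A_sum w w0) P \<sigma> s t \<Longrightarrow> alg_ge (A_sum w w0) s t"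
  by (erule wpo.cases) (auto simp: alg_ge_A_sum_iff alg_gt_A_sum_iff)

lemma kbo_imp_occ_wt:
  "kbo w w0 P \<sigma> s t \<Longrightarrow> (\<forall>x. occ x s \<ge> occ x t) \<and> wt w w0 s \<ge> wt w w0 t"
  by (erule kbo.cases) auto

section \<open>Terms, arguments and lexicographic extensions\<close>

lemma occ_nth_le: "i < length ss \<Longrightarrow> occ x (ss ! i) \<le> occ x (Fun f ss)"
  by (simp add: elem_le_sum_list[of i "map (occ x) ss", simplified])

lemma wt_nth_le: "i < length ss \<Longrightarrow> wt w w0 (ss ! i) \<le> wt w w0 (Fun f ss)"
  using elem_le_sum_list[of i "map (wt w w0) ss"] by simp

lemma occ_stack: "occ x (stack fs t) = occ x t"
  by (induction fs) (simp_all add: stack_def)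

text \<open>Rule \<open>arg\<close> strips one symbol at a time, since each layer keeps the
  occurrences and cannot lower the weight. This covers the variable rule of KBO.\<close>

lemma wpo_stack_Var: "fs \<noteq> [] \<Longrightarrow> wpo (A_sum w w0) P \<sigma> (stack fs (Var y)) (Var y)"
proof (induction fs)
  case (Cons f fs)
  let ?s = "stack fs (Var y)"
  have eq: "stack (f # fs) (Var y) = Fun f [?s]" by (simp add: stack_def)
  have "wpo (A_sum w w0) P \<sigma> ?s (Var y) \<or> ?s = Var y"
    using Cons.IH by (cases fs) (auto simp: stack_def)
  moreover have "alg_ge (A_sum w w0) (Fun f [?s]) (Var y)"
    by (simp add: alg_ge_A_sum_iff occ_stack wt_stack)
  ultimately show ?case unfolding eq by (intro wpo.arg[where i = 0]) auto
qed simp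

text \<open>Restricting to entries of the two lists matters because the implication between the
  orders is known only for well-formed terms.\<close>

lemma lex_ext_mono_on:
  assumes "lex_ext R ss ts" "\<And>s t. s \<in> set ss \<Longrightarrow> t \<in> set ts \<Longrightarrow> R s t \<Longrightarrow> S s t"
  shows "lex_ext S ss ts"
proof -
  obtain k where k: "k < length ss" "k \<le> length ts" "\<forall>i<k. R (ss ! i) (ts ! i) \<or> ss ! i = ts ! i"
    "k = length ts \<or> k < length ts \<and> R (ss ! k) (ts ! k)"
    using assms(1) unfolding lex_ext_def by blast
  have "S (ss ! i) (ts ! i)" if "i < length ss" "i < length ts" "R (ss ! i) (ts ! i)" for i
    using assms(2) that by simp
  then show ?thesis unfolding lex_ext_def using k by (intro exI[of _ k]) auto
qed

lemma lex_ext_singleton_right: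
  assumes "lex_ext R ss [t]"
  shows "\<exists>s\<in>set ss. R s t \<or> s = t"
proof
  show "R (ss ! 0) t \<or> ss ! 0 = t" using assms by (auto simp: lex_ext_def le_Suc_eq)
  show "ss ! 0 \<in> set ss" using assms by (intro nth_mem) (auto simp: lex_ext_def)
qed

lemma lex_ext_singleton_left: "ts = [] \<or> R s (hd ts) \<Longrightarrow> lex_ext R [s] ts"
  unfolding lex_ext_def by (cases ts) auto

section \<open>Positive weights and the arguments of a term\<close>

locale weighted_signature =
  fixes Sig :: "'f set" and ar :: "'f \<Rightarrow> nat" and w :: "'f \<Rightarrow> nat" and w0 :: nat
    and P :: "'f \<Rightarrow> 'f \<Rightarrow> bool" and \<sigma> :: "'f \<Rightarrow> nat list"
  assumes weight_function: "weight_function Sig ar w w0"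
    and reflp: "reflp_on Sig P"
    and status: "status Sig ar \<sigma>"
    and w0_pos: "w0 > 0"
    and admissible: "admissible Sig ar w P"
begin

abbreviation wf :: "('f, 'v) trm \<Rightarrow> bool" where "wf \<equiv> wf_trm Sig ar"
abbreviation kb :: "('f, 'v) trm \<Rightarrow> ('f, 'v) trm \<Rightarrow> bool" where "kb \<equiv> kbo w w0 P \<sigma>"
abbreviation wp :: "('f, 'v) trm \<Rightarrow> ('f, 'v) trm \<Rightarrow> bool" where "wp \<equiv> wpo (A_sum w w0) P \<sigma>"

lemma set_permute:
  assumes "wf (Fun f ss)"
  shows "set (permute (\<sigma> f) ss) = set ss"
proof -
  have "set (\<sigma> f) = {0..<length ss}" using assms status by (simp add: status_def)
  then show ?thesis by (auto simp: permute_def in_set_conv_nth)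
qed

lemma permute_unary:
  assumes "wf (Fun f [s])"
  shows "permute (\<sigma> f) [s] = [s]"
proof -
  have "distinct (\<sigma> f)" "set (\<sigma> f) = {0}" using assms status by (auto simp: status_def)
  then have "\<sigma> f = [0]" by (cases "\<sigma> f"; cases "tl (\<sigma> f)") auto
  then show ?thesis by (simp add: permute_def)
qed

lemma hd_permute:
  assumes "wf (Fun f ss)"
  shows "permute (\<sigma> f) ss = [] \<or> (\<exists>i<length ss. hd (permute (\<sigma> f) ss) = ss ! i)"
  using set_permute[OF assms] by (metis hd_in_set in_set_conv_nth)

lemma wt_ge_w0: "wf s \<Longrightarrow> wt w w0 s \<ge> w0"
proof (induction s)
  case (Fun f ss)
  show ?case
  proof (cases ss)
    case Nil
    then show ?thesis using Fun.prems weight_function by (simp add: weight_function_def)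
  next
    case (Cons s ss')
    then have "w0 \<le> wt w w0 s" using Fun by simp
    then show ?thesis using Cons by simp
  qed
qed simp

text \<open>Every further argument would weigh at least \<open>w0 > 0\<close>, so a tie with one
  argument leaves room for no other argument and no weight of \<open>f\<close>.\<close>

lemma unary_if_wt_nth_ge:
  assumes wf: "wf (Fun f ss)" and i: "i < length ss" and le: "wt w w0 (Fun f ss) \<le> wt w w0 (ss ! i)"
  shows "ss = [ss ! i]" "w f = 0"
proof -
  have pos: "wt w w0 s > 0" if "s \<in> set ss" for s
    using wt_ge_w0[of s] wf w0_pos that by fastforce
  have split: "ss = take i ss @ ss ! i # drop (Suc i) ss" by (rule id_take_nth_drop[OF i])
  have "wt w w0 (Fun f ss) = w f + sum_list (map (wt w w0) (take i ss)) + wt w w0 (ss ! i)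
      + sum_list (map (wt w w0) (drop (Suc i) ss))"
    by (subst split) (simp del: append_take_drop_id)
  then have zero: "w f = 0" "sum_list (map (wt w w0) (take i ss)) = 0"
    "sum_list (map (wt w w0) (drop (Suc i) ss)) = 0" using le by linarith+
  have "us = []" if "sum_list (map (wt w w0) us) = 0" "set us \<subseteq> set ss" for us
    using that pos by (cases us) (fastforce simp: neq0_conv[symmetric] simp del: neq0_conv)+
  then have "take i ss = []" "drop (Suc i) ss = []"
    using zero by (metis set_take_subset, metis set_drop_subset)
  then show "ss = [ss ! i]" using split by (metis append_Nil)
  show "w f = 0" by fact
qed

lemma unary_weight_0_maximal: "f \<in> Sig \<Longrightarrow> ar f = 1 \<Longrightarrow> w f = 0 \<Longrightarrow> g \<in> Sig \<Longrightarrow> P f g"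
  using admissible by (auto simp: admissible_def)

section \<open>KBO and unary symbols of weight 0\<close>

text \<open>As \<open>f\<close> is maximal, either \<open>f \<sim> g\<close>, settled by the
  lexicographic comparison, or \<open>f\<close> is strictly above \<open>g\<close>.\<close>

lemma kbo_Fun_unaryI:
  assumes f: "f \<in> Sig" "ar f = 1" "w f = 0" and g: "g \<in> Sig"
    and "\<forall>x. occ x s \<ge> occ x (Fun g ts)" "wt w w0 s = wt w w0 (Fun g ts)"
    and wf: "wf s" and lex: "lex_ext kb [s] (permute (\<sigma> g) ts)"
  shows "kb (Fun f [s]) (Fun g ts)"
proof (cases "P g f")
  case True
  then have "equivalent P f g" using unary_weight_0_maximal[OF f g] by (simp add: equivalent_def)
  then show ?thesis using assms permute_unary[of f s] by (intro kbo.lex) auto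
next
  case False
  then have "strict P f g" using unary_weight_0_maximal[OF f g] by (simp add: strict_def)
  then show ?thesis using assms by (intro kbo.prec) auto
qed

text \<open>A tie in weight forces \<open>ss = [s]\<close> with \<open>f\<close> maximal. For
  \<open>s = g(ts)\<close> it then suffices that \<open>s\<close> exceeds the first entry of the
  permuted \<open>ts\<close>, which the induction hypothesis for \<open>s\<close> gives.\<close>

lemma kbo_arg: "wf (Fun f ss) \<Longrightarrow> i < length ss \<Longrightarrow> kb (Fun f ss) (ss ! i)"
proof (induction "size (Fun f ss)" arbitrary: f ss i rule: less_induct)
  case less
  show ?case
  proof (cases "wt w w0 (Fun f ss) > wt w w0 (ss ! i)")
    case True
    then show ?thesis using occ_nth_le[OF less.prems(2)] by (intro kbo.weight) auto
  next
    case False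
    then have un: "ss = [ss ! i]" "w f = 0"
      using unary_if_wt_nth_ge[OF less.prems] by auto
    define s where "s = ss ! i"
    have ss: "ss = [s]" using un(1) by (simp add: s_def)
    have f: "f \<in> Sig" "ar f = 1" "wf s" using less.prems(1) ss by auto
    show ?thesis
    proof (cases s)
      case (Var y)
      have "Fun f [s] = stack [f] (Var y)" by (simp add: Var stack_def)
      moreover have "equivalent P f f" using reflp f by (simp add: equivalent_def reflp_on_def)
      ultimately have "\<exists>fs. fs \<noteq> [] \<and> (\<forall>g\<in>set fs. equivalent P f g) \<and> Fun f [s] = stack fs (Var y)"
        by (intro exI[of _ "[f]"]) auto
      then have "kb (Fun f [s]) (Var y)" using un(2) by (intro kbo.var) (simp_all add: Var)
      then show ?thesis unfolding s_def[symmetric] by (simp add: ss Var)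
    next
      case (Fun g ts)
      have "kb (Fun g ts) (ts ! j)" if "j < length ts" for j
        using less.hyps[of g ts j] that f(3) by (simp add: ss Fun)
      then have "lex_ext kb [s] (permute (\<sigma> g) ts)"
        using hd_permute[of g ts] f(3) by (intro lex_ext_singleton_left) (auto simp: Fun)
      then have "kb (Fun f [s]) (Fun g ts)"
        using kbo_Fun_unaryI[where f = f and g = g and s = s and ts = ts] f un(2) by (simp add: Fun)
      then show ?thesis unfolding s_def[symmetric] by (simp add: ss Fun)
    qed
  qed
qed

text \<open>In a tie with \<open>t = g(ts)\<close> it suffices that \<open>s\<close> exceeds every
  argument of \<open>t\<close>. Lighter arguments follow by weight; otherwise \<open>g\<close> is
  unary of weight 0, and the induction descends below the root of \<open>s\<close>.\<close>

lemma kbo_unary_context: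
  assumes "f \<in> Sig" "ar f = 1" "w f = 0" "wf s" "wf t" "kb s t"
  shows "kb (Fun f [s]) t"
  using assms
proof (induction "size s" arbitrary: f s t rule: less_induct)
  case less
  note f = less.prems(1-3) and wf = less.prems(4,5) and st = less.prems(6)
  have occ: "\<forall>x. occ x s \<ge> occ x t" and ge: "wt w w0 s \<ge> wt w w0 t" using kbo_imp_occ_wt[OF st] by auto
  show ?case
  proof (cases "wt w w0 s > wt w w0 t")
    case True
    then show ?thesis using occ by (intro kbo.weight) auto
  next
    case False
    then have eq: "wt w w0 s = wt w w0 t" using ge by simp
    obtain h us where s: "s = Fun h us" using st by (cases rule: kbo.cases) auto
    show ?thesis
    proof (cases t)
      case (Var y)
      obtain fs where fs: "s = stack fs (Var y)"
        using st eq Var by (cases rule: kbo.cases) auto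
      \<comment> \<open>All symbols of \<open>fs\<close> are unary of weight 0, hence maximal and
        equivalent to \<open>f\<close>.\<close>
      have "sum_list (map w fs) = 0" using eq by (simp add: fs Var wt_stack)
      then have "equivalent P f g" if "g \<in> set fs" for g
        using that wf_stack[of Sig ar fs "Var y" g] wf(1) f unary_weight_0_maximal
        by (simp add: fs equivalent_def)
      moreover have "equivalent P f f" using reflp f by (simp add: equivalent_def reflp_on_def)
      moreover have "Fun f [s] = stack (f # fs) (Var y)" by (simp add: fs stack_def)
      ultimately have "\<exists>fs. fs \<noteq> [] \<and> (\<forall>g\<in>set fs. equivalent P f g) \<and> Fun f [s] = stack fs (Var y)"
        by (intro exI[of _ "f # fs"]) auto
      then show ?thesis unfolding Var using eq occ f(3) by (intro kbo.var) (simp_all add: Var)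
    next
      case (Fun g ts)
      have g: "g \<in> Sig" using wf(2) Fun by simp
      have "kb s (ts ! j)" if j: "j < length ts" for j
      proof (cases "wt w w0 (ts ! j) < wt w w0 t")
        case True
        then show ?thesis unfolding s using occ eq occ_nth_le[OF j, of _ g]
          by (intro kbo.weight) (auto simp: Fun s simp del: occ.simps wt.simps intro: order_trans)
      next
        case False
        then have un: "ts = [ts ! j]" "w g = 0"
          using unary_if_wt_nth_ge[of g ts j] j wf(2) by (auto simp: Fun)
        define u where "u = ts ! j"
        have ts: "ts = [u]" using un(1) by (simp add: u_def)
        have gu: "ar g = 1" "wf u" using wf(2) by (auto simp: Fun ts)
        have h: "wf (Fun h us)" using wf(1) by (simp add: s)
        \<comment> \<open>Maximality of \<open>g\<close> excludes rule \<open>prec\<close> and the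
          tie excludes rule \<open>weight\<close>, so \<open>s\<close> exceeds \<open>t\<close> by
          rule \<open>lex\<close>.\<close>
        have "\<not> strict P h g" using unary_weight_0_maximal[of g h] g gu un h by (simp add: strict_def)
        then have "lex_ext kb (permute (\<sigma> h) us) (permute (\<sigma> g) ts)"
          using st eq unfolding s Fun by (auto elim: kbo.cases)
        then have "lex_ext kb (permute (\<sigma> h) us) [u]"
          using permute_unary[of g u] wf(2) by (simp add: Fun ts)
        then obtain i where i: "i < length us" "kb (us ! i) u \<or> us ! i = u"
          using lex_ext_singleton_right set_permute[OF h] by (metis in_set_conv_nth)
        \<comment> \<open>The argument \<open>us ! i\<close> now weighs as much as \<open>s\<close>,
          so \<open>h\<close> is itself unary of weight 0.\<close>
        then have "wt w w0 (us ! i) \<ge> wt w w0 u" using kbo_imp_occ_wt by blast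
        also have "wt w w0 u = wt w w0 (Fun h us)" using eq un(2) by (simp add: s Fun ts)
        finally have un': "us = [us ! i]" "w h = 0" using unary_if_wt_nth_ge[OF h i(1)] by auto
        define v where "v = us ! i"
        have us: "us = [v]" using un'(1) by (simp add: v_def)
        from i(2) have "kb (Fun h [v]) u"
        proof
          assume "kb (us ! i) u"
          then have "kb v u" by (simp add: v_def)
          then show ?thesis using less.hyps[of v h u] h un'(2) gu(2) by (simp add: s us)
        next
          assume "us ! i = u"
          then show ?thesis using kbo_arg[OF h i(1)] us by simp
        qed
        then show ?thesis by (simp add: s us u_def)
      qed
      then have "lex_ext kb [s] (permute (\<sigma> g) ts)"
        using hd_permute[of g ts] wf(2) by (intro lex_ext_singleton_left) (auto simp: Fun)
      then show ?thesis using kbo_Fun_unaryI[OF f g _ _ wf(1)] occ eq by (simp add: Fun)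
    qed
  qed
qed

section \<open>Comparison of the two orders\<close>

text \<open>An argument lighter than \<open>Fun g ts\<close> is handled by rule \<open>alg\<close>;
  a tie leaves only the unary case of weight 0.\<close>

lemma wpo_argsI:
  assumes ge: "alg_ge (A_sum w w0) (Fun f ss) (Fun g ts)"
    and wf: "wf (Fun g ts)"
    and un: "\<And>t. ts = [t] \<Longrightarrow> ar g = 1 \<Longrightarrow> w g = 0 \<Longrightarrow> wp (Fun f ss) t"
  shows "\<forall>j<length ts. wp (Fun f ss) (ts ! j)"
proof (intro allI impI)
  fix j assume j: "j < length ts"
  show "wp (Fun f ss) (ts ! j)"
  proof (cases "wt w w0 (ts ! j) < wt w w0 (Fun g ts)")
    case True
    then show ?thesis using ge occ_nth_le[OF j, of _ g]
      by (intro wpo.alg) (auto simp: alg_ge_A_sum_iff alg_gt_A_sum_iff simp del: occ.simps wt.simps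
          intro: order_trans)
  next
    case False
    then have "ts = [ts ! j]" "w g = 0" using unary_if_wt_nth_ge[OF wf j] by auto
    moreover from this have "ar g = 1" using wf by (metis wf_trm.simps(2) length_Cons list.size(3) One_nat_def)
    ultimately show ?thesis by (intro un)
  qed
qed

lemma kbo_imp_wpo: "kb s t \<Longrightarrow> wf s \<Longrightarrow> wf t \<Longrightarrow> wp s t"
proof (induction rule: kbo.induct)
  case (weight f ss t)
  then show ?case by (intro wpo.alg) (auto simp: alg_gt_A_sum_iff)
next
  case (var f ss y)
  then show ?case using wpo_stack_Var by metis
next
  case (prec f ss g ts)
  then have ge: "alg_ge (A_sum w w0) (Fun f ss) (Fun g ts)"
    by (simp only: alg_ge_A_sum_iff order_refl simp_thms)
  have "\<forall>j<length ts. wp (Fun f ss) (ts ! j)"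
  proof (rule wpo_argsI[OF ge prec.prems(2)])
    assume "ar g = 1" "w g = 0"
    \<comment> \<open>In the exceptional case \<open>g\<close> is maximal, contradicting that
      \<open>f\<close> is strictly above it.\<close>
    then have "P g f" using unary_weight_0_maximal[of g f] prec.prems by simp
    then show "wp (Fun f ss) t" for t using \<open>strict P f g\<close> by (simp add: strict_def)
  qed
  then show ?case using ge \<open>strict P f g\<close> by (intro wpo.prec)
next
  case (lex f ss g ts)
  then have ge: "alg_ge (A_sum w w0) (Fun f ss) (Fun g ts)"
    by (simp only: alg_ge_A_sum_iff order_refl simp_thms)
  have lex': "lex_ext wp (permute (\<sigma> f) ss) (permute (\<sigma> g) ts)"
    using lex.IH
  proof (rule lex_ext_mono_on)
    fix s t assume "s \<in> set (permute (\<sigma> f) ss)" "t \<in> set (permute (\<sigma> g) ts)"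
    then have "wf s" "wf t" using lex.prems by (simp_all only: set_permute) auto
    then show "wp s t" if "kb s t \<and> (wf s \<longrightarrow> wf t \<longrightarrow> wp s t)" using that by blast
  qed
  have "\<forall>j<length ts. wp (Fun f ss) (ts ! j)"
  proof (rule wpo_argsI[OF ge lex.prems(2)])
    fix t assume t: "ts = [t]"
    \<comment> \<open>Comparison with a one-element list yields an argument of \<open>f\<close> at
      least \<open>t\<close>, so rule \<open>arg\<close> applies.\<close>
    then obtain i where "i < length ss" "wp (ss ! i) t \<or> ss ! i = t"
      using lex' lex.prems permute_unary[of g t] set_permute[of f ss] lex_ext_singleton_right
      by (metis in_set_conv_nth)
    moreover have "alg_ge (A_sum w w0) (Fun f ss) t"
      using ge by (simp add: alg_ge_A_sum_iff t)
    ultimately show "wp (Fun f ss) t" by (intro wpo.arg)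
  qed
  then show ?case using ge lex' \<open>equivalent P f g\<close> by (intro wpo.lex)
qed

text \<open>Rules \<open>prec\<close> and \<open>lex\<close> turn into their KBO namesakes in a tie
  and into rule \<open>weight\<close> otherwise; the work lies in rule \<open>arg\<close>.\<close>

lemma wpo_imp_kbo: "wp s t \<Longrightarrow> wf s \<Longrightarrow> wf t \<Longrightarrow> kb s t"
proof (induction rule: wpo.induct)
  case (alg f ss t)
  then show ?case by (intro kbo.weight) (auto simp: alg_gt_A_sum_iff)
next
  case (arg f ss t i)
  note wfs = \<open>wf (Fun f ss)\<close>
  show ?case
  proof (cases "wt w w0 (Fun f ss) > wt w w0 t")
    case True
    then show ?thesis using arg.hyps(1) by (intro kbo.weight) (auto simp: alg_ge_A_sum_iff)
  next
    case False
    \<comment> \<open>The weight of \<open>ss ! i\<close> is squeezed between those of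
      \<open>t\<close> and \<open>Fun f ss\<close>, so \<open>f\<close> is unary of weight
      0.\<close>
    have "wt w w0 (ss ! i) \<ge> wt w w0 t" using arg.IH wpo_imp_alg_ge alg_ge_A_sum_iff by blast
    then have un: "ss = [ss ! i]" "w f = 0"
      using False unary_if_wt_nth_ge[OF wfs \<open>i < length ss\<close>] by linarith+
    have si: "wf (ss ! i)" using wfs \<open>i < length ss\<close> by simp
    have f: "f \<in> Sig" "ar f = 1" using wfs un(1)
      by (simp, metis wf_trm.simps(2) length_Cons list.size(3) One_nat_def)
    consider "kb (ss ! i) t" | "ss ! i = t" using arg.IH si arg.prems by blast
    then show ?thesis
    proof cases
      case 1
      then show ?thesis using kbo_unary_context[OF f un(2) si \<open>wf t\<close>] un(1) by metis
    next
      case 2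
      then show ?thesis using kbo_arg[OF wfs \<open>i < length ss\<close>] by simp
    qed
  qed
next
  case (prec f ss g ts)
  have occ: "\<forall>x. occ x (Fun f ss) \<ge> occ x (Fun g ts)" and ge: "wt w w0 (Fun f ss) \<ge> wt w w0 (Fun g ts)"
    using prec.hyps(1)[unfolded alg_ge_A_sum_iff] by simp_all
  show ?case
    using kbo.weight[OF occ] kbo.prec[OF occ _ \<open>strict P f g\<close>] ge by (metis le_neq_implies_less)
next
  case (lex f ss g ts)
  have occ: "\<forall>x. occ x (Fun f ss) \<ge> occ x (Fun g ts)" and ge: "wt w w0 (Fun f ss) \<ge> wt w w0 (Fun g ts)"
    using lex.hyps(1)[unfolded alg_ge_A_sum_iff] by simp_all
  have "lex_ext kb (permute (\<sigma> f) ss) (permute (\<sigma> g) ts)"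
    using lex.IH(2)
  proof (rule lex_ext_mono_on)
    fix s t assume "s \<in> set (permute (\<sigma> f) ss)" "t \<in> set (permute (\<sigma> g) ts)"
    then have "wf s" "wf t" using lex.prems by (simp_all only: set_permute) auto
    then show "kb s t" if "wp s t \<and> (wf s \<longrightarrow> wf t \<longrightarrow> kb s t)" using that by blast
  qed
  then show ?case
    using kbo.weight[OF occ] kbo.lex[OF occ _ \<open>equivalent P f g\<close>] ge by (metis le_neq_implies_less)
qed

end

theorem theorem16:
  fixes Sig :: "'f set" and ar :: "'f \<Rightarrow> nat"
    and w :: "'f \<Rightarrow> nat" and w0 :: nat
    and P :: "'f \<Rightarrow> 'f \<Rightarrow> bool" and \<sigma> :: "'f \<Rightarrow> nat list"
  assumes "finite Sig"
    and "weight_function Sig ar w w0"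
    and "quasi_precedence Sig P"
    and "status Sig ar \<sigma>"
    and "w0 > 0"
    and "admissible Sig ar w P"
  shows "(WPO Sig ar (A_sum w w0) P \<sigma> :: (('f, 'v) trm \<times> ('f, 'v) trm) set)
    = KBO Sig ar w w0 P \<sigma>"
proof -
  interpret weighted_signature Sig ar w w0 P \<sigma>
    using assms by unfold_locales (simp_all add: quasi_precedence_def)
  show ?thesis using kbo_imp_wpo wpo_imp_kbo by (auto simp: WPO_def KBO_def terms_def)
qed

end
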